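(* Let $k\in\{2,3\}$ and let $G$ be a $k$-cactus with $n$ vertices. Then $|E(G)|\le \left\lfloor \frac{(2k+1)(n-1)}{k+1}\right\rfloor$. Moreover, this bound is tight: for each $k\in\{2,3\}$ and each $n\ge 1$ there is a $k$-cactus with $n$ vertices and exactly $\left\lfloor \frac{(2k+1)(n-1)}{k+1}\right\rfloor$ edges.
   Context: All graphs are finite and simple. For an integer $k\ge 1$, a $k$-cactus is a connected graph in which every edge is contained in at most $k$ cycles. *)

theory Defs
  imports Complex_Main
begin

definition simple_graph :: "'a set \<Rightarrow> 'a set set \<Rightarrow> bool" where
  "simple_graph V E \<longleftrightarrow> finite V \<and> (\<forall>e\<in>E. e \<subseteq> V \<and> card e = 2)"

(* The null graph does not count as connected. *)
definition connected_graph :: "'a set \<Rightarrow> 'a set set \<Rightarrow> bool" where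
  "connected_graph V E \<longleftrightarrow>
     V \<noteq> {} \<and> (\<forall>u\<in>V. \<forall>v\<in>V. (u, v) \<in> {(x, y). {x, y} \<in> E}\<^sup>*)"

(* xs is read cyclically: its last vertex is joined to its first. *)
definition cycle_edges :: "'a list \<Rightarrow> 'a set set" where
  "cycle_edges xs = {{xs ! i, xs ! (Suc i mod length xs)} | i. i < length xs}"

(* A cycle is a subgraph, represented by its edge set, so that rotations and
   reversals of one closed vertex sequence are counted only once. *)
definition cycles :: "'a set set \<Rightarrow> 'a set set set" where
  "cycles E = {C. C \<subseteq> E \<and> (\<exists>xs. 3 \<le> length xs \<and> distinct xs \<and> C = cycle_edges xs)}"

definition k_cactus :: "nat \<Rightarrow> 'a set \<Rightarrow> 'a set set \<Rightarrow> bool" where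
  "k_cactus k V E \<longleftrightarrow>
     simple_graph V E \<and> connected_graph V E \<and>
     (\<forall>e\<in>E. card {C \<in> cycles E. e \<in> C} \<le> k)"

end

theory Submission
  imports Defs
begin

text \<open>
  Call an edge set even if it has even degree at every vertex; every edge of an even set lies on a
  cycle inside that set. Fix a spanning tree T. An even set is determined by its edges outside T, and
  every edge f outside T has a fundamental cycle, whose part in T is a path P f. If P f meets P g, then
  the symmetric difference of the two fundamental cycles is again a cycle through f. Hence f meets at
  most k - 1 others, and for k at most 3 a fourth cycle through f appears unless meeting is
  transitive. The classes of this equivalence thus have some size s with s at most k, and the paths of
  one class cover at least s + 1 edges of T, while different classes cover disjoint sets. So
  (k + 1) |E - T| is at most k |T|, which is the bound.

  Tightness is attained by a vertex 0 joined to all vertices of a disjoint union of stars with at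
  most k leaves each.
\<close>

section \<open>Even edge sets and cycles\<close>

text \<open>For finite edge sets these are the members of the cycle space over the two-element
  field, with \<open>sym_diff\<close> as addition.\<close>

definition even_degrees :: "'a set set \<Rightarrow> bool" where
  "even_degrees A \<longleftrightarrow> (\<forall>v. even (card {e \<in> A. v \<in> e}))"

lemma odd_card_sym_diff:
  assumes "finite A" "finite B"
  shows "odd (card (sym_diff A B)) \<longleftrightarrow> odd (card A) \<noteq> odd (card B)"
proof -
  have "card A = card (A - B) + card (A \<inter> B)"
    using card_Diff_subset_Int[of A B] card_mono[of A "A \<inter> B"] assms by simp
  moreover have "card B = card (B - A) + card (A \<inter> B)"
    using card_Diff_subset_Int[of B A] card_mono[of B "A \<inter> B"] assms by (simp add: Int_commute)
  moreover have "card (sym_diff A B) = card (A - B) + card (B - A)"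
    using assms by (intro card_Un_disjoint) auto
  ultimately show ?thesis by auto
qed

lemma odd_degree_sym_diff:
  assumes "finite A" "finite B"
  shows "odd (card {e \<in> sym_diff A B. v \<in> e}) \<longleftrightarrow>
    odd (card {e \<in> A. v \<in> e}) \<noteq> odd (card {e \<in> B. v \<in> e})"
proof -
  have "{e \<in> sym_diff A B. v \<in> e} = sym_diff {e \<in> A. v \<in> e} {e \<in> B. v \<in> e}"
    by auto
  then show ?thesis
    using odd_card_sym_diff[of "{e \<in> A. v \<in> e}" "{e \<in> B. v \<in> e}"] assms by simp
qed

lemma even_degrees_sym_diff:
  assumes "finite A" "finite B" "even_degrees A" "even_degrees B"
  shows "even_degrees (sym_diff A B)"
  using odd_degree_sym_diff[OF assms(1,2)] assms(3,4) unfolding even_degrees_def by simp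

lemma even_degrees_other_edge:
  assumes "even_degrees A" "e \<in> A" "v \<in> e"
  shows "\<exists>e'\<in>A. e' \<noteq> e \<and> v \<in> e'"
proof (rule ccontr)
  assume "\<not> ?thesis"
  then have "{e \<in> A. v \<in> e} = {e}" using assms by auto
  then have "card {e \<in> A. v \<in> e} = 1" by simp
  then show False using assms(1) unfolding even_degrees_def by (metis odd_one)
qed

text \<open>Leave an edge {u, v} at u by a second edge {u, w}, and leave that one at w by a third.
  As w is neither u nor v, the third edge is not the first.\<close>

lemma even_degrees_card_ge_3:
  assumes "finite A" "\<forall>e\<in>A. card e = 2" "even_degrees A" "A \<noteq> {}"
  shows "card A \<ge> 3"
proof -
  obtain e where e: "e \<in> A" using assms by blast
  then obtain u v where uv: "e = {u, v}" "u \<noteq> v" using assms(2) by (meson card_2_iff)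
  obtain e' where e': "e' \<in> A" "e' \<noteq> e" "u \<in> e'"
    using even_degrees_other_edge[OF assms(3) e, of u] uv by auto
  then obtain w where w: "e' = {u, w}" "u \<noteq> w"
    using assms(2) by (metis card_2_iff doubleton_eq_iff insertE singletonD)
  obtain e'' where e'': "e'' \<in> A" "e'' \<noteq> e'" "w \<in> e''"
    using even_degrees_other_edge[OF assms(3) e'(1), of w] w by auto
  have "e'' \<noteq> e" using e'' w uv e' by auto
  then have "card {e, e', e''} = 3" using e' e'' by auto
  moreover have "{e, e', e''} \<subseteq> A" using e e' e'' by auto
  ultimately show ?thesis using card_mono[OF assms(1)] by metis
qed

lemma cycle_degree:
  assumes "distinct xs" "3 \<le> length xs"
  shows "card {e \<in> cycle_edges xs. v \<in> e} = (if v \<in> set xs then 2 else 0)"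
proof (cases "v \<in> set xs")
  case False
  have "{e \<in> cycle_edges xs. v \<in> e} = {}"
  proof -
    have "Suc i mod length xs < length xs" for i
      using assms(2) by (intro mod_less_divisor) linarith
    then have "e \<subseteq> set xs" if "e \<in> cycle_edges xs" for e
      using that nth_mem unfolding cycle_edges_def by auto
    then show ?thesis using False by blast
  qed
  then show ?thesis using False by (metis card.empty)
next
  case True
  let ?n = "length xs"
  let ?e = "\<lambda>i. {xs ! i, xs ! (Suc i mod ?n)}"
  obtain j where j: "j < ?n" "v = xs ! j" using True by (metis in_set_conv_nth)
  \<comment> \<open>The cyclic predecessor of j: the edges at v are those with indices j and
    j'.\<close>
  define j' where "j' = (if j = 0 then ?n - 1 else j - 1)"
  have j': "j' < ?n" "Suc j' mod ?n = j"
    using j assms(2) by (auto simp: j'_def)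
  have uniq: "i = j'" if "i < ?n" "Suc i mod ?n = j" for i
    using that j assms(2) by (cases "Suc i = ?n") (auto simp: j'_def)
  have m: "Suc i mod ?n < ?n" for i
    using assms(2) by (intro mod_less_divisor) linarith
  have "{e \<in> cycle_edges xs. v \<in> e} = {?e j, ?e j'}"
  proof (intro equalityI subsetI)
    fix e assume "e \<in> {e \<in> cycle_edges xs. v \<in> e}"
    then obtain i where i: "i < ?n" "e = ?e i" "v \<in> ?e i"
      unfolding cycle_edges_def by auto
    then have "i = j \<or> Suc i mod ?n = j"
      using j m[of i] nth_eq_iff_index_eq[OF assms(1)] by auto
    then show "e \<in> {?e j, ?e j'}" using i uniq by auto
  next
    fix e assume "e \<in> {?e j, ?e j'}"
    then show "e \<in> {e \<in> cycle_edges xs. v \<in> e}"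
      using j j' unfolding cycle_edges_def by auto
  qed
  \<comment> \<open>Equal edges would make the successor of j its predecessor, which a length of at
    least 3 excludes.\<close>
  moreover have "?e j \<noteq> ?e j'"
  proof
    assume "?e j = ?e j'"
    then have "xs ! (Suc j mod ?n) = xs ! j'"
      unfolding j'(2) by (metis doubleton_eq_iff)
    then have "Suc j mod ?n = j'"
      using m[of j] j' nth_eq_iff_index_eq[OF assms(1)] by auto
    then show False using j assms(2)
      by (cases "Suc j = ?n") (auto simp: j'_def split: if_splits)
  qed
  ultimately have "card {e \<in> cycle_edges xs. v \<in> e} = 2" by simp
  then show ?thesis using True by simp
qed

lemma cycle_degrees: "C \<in> cycles E \<Longrightarrow> card {e \<in> C. v \<in> e} \<in> {0, 2}"
  unfolding cycles_def by (auto simp: cycle_degree simp del: card_eq_0_iff split: if_splits)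

lemma cycle_even_degrees: "C \<in> cycles E \<Longrightarrow> even_degrees C"
proof -
  assume "C \<in> cycles E"
  then have "even (card {e \<in> C. v \<in> e})" for v using cycle_degrees[of C E v] by auto
  then show ?thesis by (simp add: even_degrees_def)
qed

section \<open>Cycles through the edges of an even set\<close>

lemma rtrancl_distinct_path:
  assumes "(u, v) \<in> R\<^sup>*"
  shows "\<exists>xs. xs \<noteq> [] \<and> distinct xs \<and> hd xs = u \<and> last xs = v \<and>
    (\<forall>i. Suc i < length xs \<longrightarrow> (xs ! i, xs ! Suc i) \<in> R)"
  using assms
proof (induction rule: rtrancl_induct)
  case base
  show ?case by (rule exI[of _ "[u]"]) auto
next
  case (step y z)
  then obtain xs where xs: "xs \<noteq> []" "distinct xs" "hd xs = u" "last xs = y"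
    "\<forall>i. Suc i < length xs \<longrightarrow> (xs ! i, xs ! Suc i) \<in> R" by blast
  show ?case
  proof (cases "z \<in> set xs")
    case True
    \<comment> \<open>The path has visited z before, so it is cut back to that visit.\<close>
    then obtain ys zs where yz: "xs = (ys @ [z]) @ zs" by (metis split_list append.assoc append_Cons append_Nil)
    have "((ys @ [z]) ! i, (ys @ [z]) ! Suc i) \<in> R" if "Suc i < length (ys @ [z])" for i
    proof -
      have "(xs ! i, xs ! Suc i) \<in> R" using xs(5) that yz by auto
      then show ?thesis using that unfolding yz by (metis Suc_lessD nth_append)
    qed
    moreover have "hd (ys @ [z]) = u" using xs(3) yz by (cases ys) auto
    ultimately show ?thesis using xs(2) yz by (intro exI[of _ "ys @ [z]"]) auto
  next
    case False
    have "((xs @ [z]) ! i, (xs @ [z]) ! Suc i) \<in> R" if "Suc i < length (xs @ [z])" for i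
    proof (cases "Suc i < length xs")
      case True
      then show ?thesis using xs(5) by (simp add: nth_append)
    next
      case False
      then have "Suc i = length xs" using that by simp
      then have "xs ! i = y" "i < length xs"
        using xs(1,4) last_conv_nth[of xs] by (auto simp flip: \<open>Suc i = length xs\<close>)
      then show ?thesis using step(2) \<open>Suc i = length xs\<close> by (simp add: nth_append)
    qed
    then show ?thesis using False xs by (intro exI[of _ "xs @ [z]"]) auto
  qed
qed

text \<open>Handshake argument: exchanging the sums counts each edge by its ends in K, and these are
  both of its ends or none.\<close>

lemma even_sum_degrees_closed:
  assumes "finite F" "finite K" "\<forall>e\<in>F. card e = 2" "\<forall>e\<in>F. e \<subseteq> K \<or> e \<inter> K = {}"
  shows "even (\<Sum>w\<in>K. card {e \<in> F. w \<in> e})"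
proof -
  have "(\<Sum>w\<in>K. card {e \<in> F. w \<in> e}) = (\<Sum>e\<in>F. card {w \<in> K. w \<in> e})"
    using sum.swap_restrict[OF assms(2,1), of "\<lambda>_ _. 1::nat" "\<lambda>w e. w \<in> e"] by simp
  also have "even \<dots>"
  proof (rule dvd_sum)
    fix e assume e: "e \<in> F"
    then have "{w \<in> K. w \<in> e} = e \<or> {w \<in> K. w \<in> e} = {}" using assms(4) by blast
    then show "even (card {w \<in> K. w \<in> e})" using e assms(3) by (metis card.empty even_zero dvd_refl)
  qed
  finally show ?thesis .
qed

text \<open>The ends u and v of f stay connected in \<open>A - {f}\<close>, and a path between them
  closes up with f. Otherwise the component of u in \<open>A - {f}\<close> would have u as its only
  vertex of odd degree, against the handshake argument.\<close>

lemma even_degrees_edge_in_cycle: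
  assumes "finite A" "\<forall>e\<in>A. card e = 2" "even_degrees A" "f \<in> A"
  shows "\<exists>C\<in>cycles A. f \<in> C"
proof -
  obtain u v where uv: "f = {u, v}" "u \<noteq> v" using assms(2,4) by (meson card_2_iff)
  define F where "F = A - {f}"
  define R where "R = {(x, y). {x, y} \<in> F}"
  \<comment> \<open>The component of u. All vertices reachable from u lie in
    \<open>\<Union>A\<close>, so the intersection only makes finiteness evident.\<close>
  define K where "K = {w. (u, w) \<in> R\<^sup>*} \<inter> \<Union>A"
  have "finite (\<Union>A)" using assms(1,2) by (metis card.infinite finite_Union zero_neq_numeral)
  then have finK: "finite K" by (simp add: K_def)
  have "(u, v) \<in> R\<^sup>*"
  proof (rule ccontr)
    assume not: "(u, v) \<notin> R\<^sup>*"
    have deg: "card {e \<in> A. w \<in> e} = card {e \<in> F. w \<in> e} + (if w \<in> f then 1 else 0)" for w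
    proof -
      have "{e \<in> A. w \<in> e} = (if w \<in> f then insert f {e \<in> F. w \<in> e} else {e \<in> F. w \<in> e})"
        using assms(4) by (auto simp: F_def)
      then show ?thesis using assms(1) by (auto simp: F_def)
    qed
    have evA: "even (card {e \<in> A. w \<in> e})" for w
      using assms(3) unfolding even_degrees_def by blast
    have uK: "u \<in> K" using assms(4) uv by (auto simp: K_def)
    have vK: "v \<notin> K" using not by (auto simp: K_def)
    have step: "y \<in> K" if "x \<in> K" "{x, y} \<in> F" for x y
      using that unfolding K_def F_def R_def by (auto intro: rtrancl_into_rtrancl)
    have "e \<subseteq> K \<or> e \<inter> K = {}" if "e \<in> F" for e
    proof -
      have "card e = 2" using assms(2) that by (simp add: F_def)
      then obtain x y where e: "e = {x, y}" by (meson card_2_iff)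
      have "{x, y} \<in> F" "{y, x} \<in> F" using that e by (simp_all add: insert_commute)
      then have "x \<in> K \<longleftrightarrow> y \<in> K" using step by blast
      then show ?thesis using e by auto
    qed
    then have "even (\<Sum>w\<in>K. card {e \<in> F. w \<in> e})"
      using even_sum_degrees_closed[of F K] finK assms(1,2) by (auto simp: F_def)
    also have "(\<Sum>w\<in>K. card {e \<in> F. w \<in> e})
        = card {e \<in> F. u \<in> e} + (\<Sum>w\<in>K-{u}. card {e \<in> F. w \<in> e})"
      using finK uK by (rule sum.remove)
    finally have ev: "even (card {e \<in> F. u \<in> e} + (\<Sum>w\<in>K-{u}. card {e \<in> F. w \<in> e}))" .
    have "even (\<Sum>w\<in>K-{u}. card {e \<in> F. w \<in> e})"
    proof (rule dvd_sum)
      fix w assume "w \<in> K - {u}"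
      then have "w \<notin> f" using uv vK by auto
      then show "even (card {e \<in> F. w \<in> e})"
        using deg[of w] evA[of w] by simp
    qed
    moreover have "odd (card {e \<in> F. u \<in> e})"
      using deg[of u] evA[of u] uv by simp
    ultimately show False using ev by simp
  qed
  then obtain xs where xs: "xs \<noteq> []" "distinct xs" "hd xs = u" "last xs = v"
    "\<forall>i. Suc i < length xs \<longrightarrow> (xs ! i, xs ! Suc i) \<in> R"
    using rtrancl_distinct_path by metis
  \<comment> \<open>One vertex would give u = v, and two would make f an edge of
    \<open>F\<close>.\<close>
  have len: "3 \<le> length xs"
  proof (rule ccontr)
    assume "\<not> 3 \<le> length xs"
    moreover have "length xs \<noteq> 0" using xs(1) by simp
    ultimately have "length xs = 1 \<or> length xs = 2" by linarith
    then show False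
    proof
      assume "length xs = 1"
      then show False using xs uv by (auto simp: length_Suc_conv)
    next
      assume l: "length xs = 2"
      then have "xs ! 0 = u" "xs ! 1 = v"
        using xs by (auto simp: hd_conv_nth last_conv_nth)
      then have "f \<in> F" using xs(5) l uv by (auto simp: R_def)
      then show False by (simp add: F_def)
    qed
  qed
  have ends: "xs ! 0 = u" "xs ! (length xs - 1) = v"
    using xs by (auto simp: hd_conv_nth last_conv_nth)
  have "e \<in> A" if mem: "e \<in> cycle_edges xs" for e
  proof -
    obtain i where i: "i < length xs" "e = {xs ! i, xs ! (Suc i mod length xs)}"
      using mem unfolding cycle_edges_def by auto
    show ?thesis
    proof (cases "Suc i < length xs")
      case True
      then show ?thesis using i xs(5) by (auto simp: R_def F_def)
    next
      case False
      then have "Suc i = length xs" using i by simp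
      then have "i = length xs - 1" "Suc i mod length xs = 0" by simp_all
      then have "e = f" using i ends uv by (simp add: insert_commute)
      then show ?thesis using assms(4) by simp
    qed
  qed
  moreover have "f \<in> cycle_edges xs"
  proof -
    have "f = {xs ! (length xs - 1), xs ! (Suc (length xs - 1) mod length xs)}"
      using ends uv xs(1) by (simp add: insert_commute)
    moreover have "length xs - 1 < length xs" using xs(1) by simp
    ultimately show ?thesis unfolding cycle_edges_def by blast
  qed
  ultimately show ?thesis using xs(2) len unfolding cycles_def by blast
qed

section \<open>Fundamental cycles\<close>

text \<open>A spanning tree is described through the cycle space: T contains no nonempty even set,
  and every further edge closes up to an even set. All counting can then be done on edges
  alone.\<close>

locale spanning_tree =
  fixes E T :: "'a set set"
  assumes finite_E: "finite E"
    and card_edge: "e \<in> E \<Longrightarrow> card e = 2"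
    and tree_sub: "T \<subseteq> E"
    and tree_acyclic: "A \<subseteq> T \<Longrightarrow> even_degrees A \<Longrightarrow> A = {}"
    and ex_fundamental: "f \<in> E - T \<Longrightarrow> \<exists>A. f \<in> A \<and> A \<subseteq> insert f T \<and> even_degrees A"
begin

abbreviation N where "N \<equiv> E - T"

text \<open>The choice is forced: by \<open>even_unique\<close> there is only one such set for each
  f outside T.\<close>

definition fund :: "'a set \<Rightarrow> 'a set set" where
  "fund f = (SOME A. f \<in> A \<and> A \<subseteq> insert f T \<and> even_degrees A)"

definition tpath :: "'a set \<Rightarrow> 'a set set" where
  "tpath f = fund f \<inter> T"

lemma fund:
  assumes "f \<in> N"
  shows "f \<in> fund f" "fund f \<subseteq> insert f T" "even_degrees (fund f)"
  using someI_ex[OF ex_fundamental[OF assms]] unfolding fund_def by auto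

lemma fund_sub: "f \<in> N \<Longrightarrow> fund f \<subseteq> E"
  using fund(2) tree_sub by blast

lemma fund_off_tree: "f \<in> N \<Longrightarrow> fund f - T = {f}"
  using fund by blast

lemma fund_eq: "f \<in> N \<Longrightarrow> fund f = insert f (tpath f)"
  using fund unfolding tpath_def by blast

lemma tpath_sub: "tpath f \<subseteq> T"
  unfolding tpath_def by blast

lemma even_degrees_diff:
  assumes "A \<subseteq> E" "B \<subseteq> E" "even_degrees A" "even_degrees B"
  shows "even_degrees (sym_diff A B)"
  using assms finite_E by (intro even_degrees_sym_diff) (auto intro: finite_subset)

text \<open>The symmetric difference of A and B is even and lies inside T, hence is empty.\<close>

lemma even_unique:
  assumes "A \<subseteq> E" "B \<subseteq> E" "even_degrees A" "even_degrees B" "A - T = B - T"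
  shows "A = B"
proof -
  have "sym_diff A B \<subseteq> T" using assms by blast
  then have "sym_diff A B = {}" using tree_acyclic even_degrees_diff[OF assms(1-4)] by blast
  then show ?thesis by blast
qed

lemma ex_cycle:
  assumes "A \<subseteq> E" "even_degrees A" "f \<in> A"
  shows "\<exists>C. C \<in> cycles E \<and> C \<subseteq> A \<and> f \<in> C"
proof -
  have "finite A" using assms finite_E finite_subset by blast
  then obtain C where "C \<in> cycles A" "f \<in> C"
    using even_degrees_edge_in_cycle[of A f] assms card_edge by blast
  then show ?thesis using assms(1) unfolding cycles_def by auto
qed

lemma even_card_ge_3:
  assumes "A \<subseteq> E" "even_degrees A" "A \<noteq> {}"
  shows "card A \<ge> 3"
  using assms even_degrees_card_ge_3[of A] card_edge finite_E by (meson finite_subset subsetD)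

lemma cycle_sub: "C \<in> cycles E \<Longrightarrow> C \<subseteq> E"
  unfolding cycles_def by blast

lemma finite_tpath: "finite (tpath f)"
  using tpath_sub tree_sub finite_E by (meson finite_subset)

lemma card_tpath: "f \<in> N \<Longrightarrow> card (tpath f) \<ge> 2"
proof -
  assume f: "f \<in> N"
  then have "card (fund f) \<ge> 3" using even_card_ge_3 fund fund_sub by (metis empty_iff)
  moreover have "f \<notin> tpath f" using f tpath_sub by blast
  ultimately show ?thesis using fund_eq[OF f] finite_tpath by simp
qed

text \<open>Otherwise the two fundamental cycles would add up to {f, g}, an even set with only two
  edges.\<close>

lemma tpath_inj:
  assumes "f \<in> N" "g \<in> N" "f \<noteq> g"
  shows "tpath f \<noteq> tpath g"
proof
  assume eq: "tpath f = tpath g"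
  let ?A = "sym_diff (fund f) (fund g)"
  have A: "?A = {f, g}" using eq fund_eq assms tpath_sub by blast
  have "even_degrees ?A" using even_degrees_diff fund fund_sub assms by metis
  then have "card {f, g} \<ge> 3" using even_card_ge_3[of ?A] A assms by auto
  then show False using assms by simp
qed

text \<open>A cycle through f inside the sum of the two fundamental cycles has off-tree part {f} or
  {f, g}. In the first case it would be \<open>fund f\<close>, whose edges shared with
  \<open>tpath g\<close> have cancelled. The case f = g is included so that the fundamental cycle is
  counted along with the others.\<close>

lemma pair_cycle:
  assumes "f \<in> N" "g \<in> N" "tpath f \<inter> tpath g \<noteq> {}"
  shows "\<exists>C\<in>cycles E. C - T = {f, g}"
proof (cases "f = g")
  case True
  obtain C where C: "C \<in> cycles E" "C \<subseteq> fund f" "f \<in> C"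
    using ex_cycle[OF fund_sub fund(3) fund(1)] assms(1) by blast
  have "C - T \<subseteq> {f}" using C(2) fund_off_tree[OF assms(1)] by auto
  then have "C - T = {f}" using C(3) assms(1) by auto
  then show ?thesis using C(1) True by auto
next
  case False
  let ?A = "sym_diff (fund f) (fund g)"
  have AE: "?A \<subseteq> E" using fund_sub assms by blast
  have "even_degrees ?A" using even_degrees_diff fund fund_sub assms by metis
  moreover have "f \<in> ?A" using fund assms False by blast
  ultimately obtain C where C: "C \<in> cycles E" "C \<subseteq> ?A" "f \<in> C"
    using ex_cycle[OF AE] by blast
  have "C - T \<subseteq> (fund f - T) \<union> (fund g - T)" using C(2) by blast
  then have "C - T \<subseteq> {f, g}" using fund_off_tree assms by auto
  moreover have "C - T \<noteq> {f}"
  proof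
    assume "C - T = {f}"
    then have "C = fund f"
      using even_unique[OF cycle_sub fund_sub cycle_even_degrees fund(3)] C assms fund_off_tree
      by metis
    then show False using C assms(3) unfolding tpath_def by blast
  qed
  ultimately have "C - T = {f, g}" using C(3) assms by blast
  then show ?thesis using C by blast
qed

text \<open>A cycle through f inside the sum of all three is determined by its off-tree part. If
  that part missed g or h, the cycle would be \<open>fund f\<close> or its sum with one of the other
  two. As the paths of g and h are disjoint, each of these contains a common edge of two paths that
  cancels in the full sum.\<close>

lemma triple_cycle_disjoint:
  assumes "f \<in> N" "g \<in> N" "h \<in> N" "tpath f \<inter> tpath g \<noteq> {}" "tpath f \<inter> tpath h \<noteq> {}"
    "tpath g \<inter> tpath h = {}"
    "f \<noteq> g" "f \<noteq> h" "g \<noteq> h"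
  shows "\<exists>C\<in>cycles E. C - T = {f, g, h}"
proof -
  let ?B = "sym_diff (fund f) (fund g)"
  let ?B' = "sym_diff (fund f) (fund h)"
  let ?A = "sym_diff ?B (fund h)"
  have BE: "?B \<subseteq> E" "?B' \<subseteq> E" "?A \<subseteq> E" using fund_sub assms by blast+
  have ev: "even_degrees ?B" "even_degrees ?B'" using even_degrees_diff fund fund_sub assms by metis+
  have evA: "even_degrees ?A" using even_degrees_diff[OF BE(1) fund_sub] ev fund assms by metis
  have off: "?B - T = {f, g}" "?B' - T = {f, h}" "?A - T = {f, g, h}"
    using fund_off_tree assms by blast+
  have "f \<in> ?A - T" unfolding off by simp
  then have fA: "f \<in> ?A" by (rule DiffD1)
  obtain C where C: "C \<in> cycles E" "C \<subseteq> ?A" "f \<in> C"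
    using ex_cycle[OF BE(3) evA fA] by meson
  note CE = cycle_sub[OF C(1)] and Ce = cycle_even_degrees[OF C(1)]
  have "C - T \<subseteq> {f, g, h}" using Diff_mono[OF C(2) subset_refl, of T] unfolding off .
  moreover have "C - T \<noteq> {f}"
  proof
    assume "C - T = {f}"
    then have "C = fund f"
      using even_unique[OF CE fund_sub Ce fund(3)] assms fund_off_tree by metis
    then show False using C(2) assms(4,6) unfolding tpath_def by blast
  qed
  moreover have "C - T \<noteq> {f, g}"
  proof
    assume "C - T = {f, g}"
    then have "C = ?B" using even_unique[OF CE BE(1) Ce ev(1)] off by metis
    then show False using C(2) assms(5,6) unfolding tpath_def by blast
  qed
  moreover have "C - T \<noteq> {f, h}"
  proof
    assume "C - T = {f, h}"
    then have "C = ?B'" using even_unique[OF CE BE(2) Ce ev(2)] off by metis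
    then show False using C(2) assms(4,6) unfolding tpath_def by blast
  qed
  ultimately have "C - T = {f, g, h}" using C(3) assms(1) by blast
  then show ?thesis using C by blast
qed

text \<open>
  Three distinct sets of at least two elements in a three-element set have a symmetric difference of
  at most one element. So the sum of the three fundamental cycles has at most four edges, too few for
  two disjoint cycles.
\<close>

lemma triple_cycle_small:
  assumes "f \<in> N" "g \<in> N" "h \<in> N" "f \<noteq> g" "f \<noteq> h" "g \<noteq> h"
    "card (tpath f \<union> tpath g \<union> tpath h) \<le> 3"
  shows "\<exists>C\<in>cycles E. C - T = {f, g, h}"
proof -
  let ?P = "sym_diff (sym_diff (tpath f) (tpath g)) (tpath h)"
  let ?A = "sym_diff (sym_diff (fund f) (fund g)) (fund h)"
  have BE: "sym_diff (fund f) (fund g) \<subseteq> E" "?A \<subseteq> E" using fund_sub assms by blast+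
  have ev: "even_degrees (sym_diff (fund f) (fund g))" using even_degrees_diff fund fund_sub assms by metis+
  have evA: "even_degrees ?A" using even_degrees_diff[OF BE(1) fund_sub] ev fund assms by metis
  have off: "?A - T = {f, g, h}" using fund_off_tree assms by blast
  have neq: "tpath f \<noteq> tpath g" "tpath f \<noteq> tpath h" "tpath g \<noteq> tpath h"
    using tpath_inj assms by blast+
  have "card ?P \<le> 1"
  proof -
    define U where "U = tpath f \<union> tpath g \<union> tpath h"
    \<comment> \<open>Two distinct paths with at least two edges each do not fit into a set of
      two.\<close>
    have "card U \<noteq> 2"
      using neq(1) card_tpath assms(1,2) finite_tpath unfolding U_def
      by (metis (no_types, lifting) card_seteq finite_UnI sup.cobounded1 sup.cobounded2 sup.coboundedI1)
    moreover have "card U \<ge> 2"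
      using card_tpath[OF assms(1)] card_mono[of U "tpath f"] finite_tpath unfolding U_def
      by (meson finite_UnI le_trans sup.cobounded1 sup.coboundedI1)
    ultimately have U: "tpath f \<union> tpath g \<union> tpath h \<subseteq> U" "card U = 3"
      using assms(7) unfolding U_def by auto
    then obtain a b c where abc: "U = {a, b, c}" "a \<noteq> b" "a \<noteq> c" "b \<noteq> c"
      by (meson card_3_iff)
    have cases: "X = {a, b} \<or> X = {a, c} \<or> X = {b, c} \<or> X = {a, b, c}"
      if "X \<subseteq> {a, b, c}" "card X \<ge> 2" for X
    proof -
      have "\<not> X \<subseteq> {x}" for x using that(2) card_mono[of "{x}" X] by auto
      then have "\<not> X \<subseteq> {a}" "\<not> X \<subseteq> {b}" "\<not> X \<subseteq> {c}" by simp_all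
      then have *: "a \<in> X \<or> b \<in> X" "a \<in> X \<or> c \<in> X" "b \<in> X \<or> c \<in> X" using that(1) by auto
      then have "X = {b, c}" if "a \<notin> X" using \<open>X \<subseteq> {a, b, c}\<close> that by blast
      moreover have "X = {a, c}" if "b \<notin> X" using * \<open>X \<subseteq> {a, b, c}\<close> that by blast
      moreover have "X = {a, b}" if "c \<notin> X" using * \<open>X \<subseteq> {a, b, c}\<close> that by blast
      moreover have "X = {a, b, c}" if "a \<in> X" "b \<in> X" "c \<in> X"
        using \<open>X \<subseteq> {a, b, c}\<close> that by blast
      ultimately show ?thesis by argo
    qed
    have "tpath f \<subseteq> {a, b, c}" "tpath g \<subseteq> {a, b, c}" "tpath h \<subseteq> {a, b, c}"
      using U abc by auto
    note c = this[THEN cases]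
    show ?thesis
      using c(1)[OF card_tpath[OF assms(1)]] c(2)[OF card_tpath[OF assms(2)]]
        c(3)[OF card_tpath[OF assms(3)]] neq abc(2-4)
      by (elim disjE) (simp_all add: insert_Diff_if)
  qed
  moreover have "?A = {f, g, h} \<union> ?P"
  proof -
    have AT: "?A \<inter> T = ?P" unfolding tpath_def by blast
    have "?A = (?A - T) \<union> (?A \<inter> T)" by blast
    also have "\<dots> = {f, g, h} \<union> ?P" by (simp only: off AT)
    finally show ?thesis .
  qed
  ultimately have "card ?A \<le> 4"
    using card_Un_le[of "{f, g, h}" ?P] assms by simp
  have "f \<in> ?A - T" unfolding off by simp
  then have fA: "f \<in> ?A" by (rule DiffD1)
  obtain C where C: "C \<in> cycles E" "C \<subseteq> ?A" "f \<in> C"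
    using ex_cycle[OF BE(2) evA fA] by meson
  note CE = cycle_sub[OF C(1)] and Ce = cycle_even_degrees[OF C(1)]
  have "?A - C = {}"
  proof (rule ccontr)
    assume ne: "?A - C \<noteq> {}"
    have "sym_diff ?A C = ?A - C" using C(2) by blast
    then have "even_degrees (?A - C)" using even_degrees_diff[OF BE(2) CE evA Ce] by simp
    then have "card (?A - C) \<ge> 3" using even_card_ge_3[of "?A - C"] ne BE(2) by blast
    moreover have "card C \<ge> 3" using even_card_ge_3[OF CE Ce] C(3) by blast
    moreover have "card ?A = card C + card (?A - C)"
      using C(2) BE(2) finite_E by (metis card_Diff_subset card_mono finite_subset le_add_diff_inverse)
    ultimately show False using \<open>card ?A \<le> 4\<close> by linarith
  qed
  then have "C = ?A" using C(2) by blast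
  then show ?thesis using C(1) off by blast
qed

end

section \<open>Classes of overlapping tree paths\<close>

locale sparse_cycles = spanning_tree +
  fixes k :: nat
  assumes cycles_le: "f \<in> E \<Longrightarrow> card {C \<in> cycles E. f \<in> C} \<le> k"
    and k_le_3: "k \<le> 3"
begin

lemma finite_cycles: "finite (cycles E)"
  by (rule finite_subset[of _ "Pow E"]) (auto simp: cycles_def finite_E)

lemma tpath_nonempty: "f \<in> N \<Longrightarrow> tpath f \<inter> tpath f \<noteq> {}"
  using card_tpath[of f] by auto

text \<open>Such a cycle would be the fourth one through f, besides those with off-tree parts {f},
  {f, g} and {f, h}.\<close>

lemma no_triple_cycle:
  assumes N: "f \<in> N" "g \<in> N" "h \<in> N" and neq: "f \<noteq> g" "f \<noteq> h" "g \<noteq> h"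
    and meet: "tpath f \<inter> tpath g \<noteq> {}" "tpath f \<inter> tpath h \<noteq> {}"
  shows "\<not> (\<exists>C\<in>cycles E. C - T = {f, g, h})"
proof
  assume "\<exists>C\<in>cycles E. C - T = {f, g, h}"
  then obtain C where C: "C \<in> cycles E" "C - T = {f, g, h}" by blast
  obtain C1 where C1: "C1 \<in> cycles E" "C1 - T = {f, f}"
    using pair_cycle[OF N(1) N(1) tpath_nonempty[OF N(1)]] by meson
  obtain C2 where C2: "C2 \<in> cycles E" "C2 - T = {f, g}"
    using pair_cycle[OF N(1) N(2) meet(1)] by meson
  obtain C3 where C3: "C3 \<in> cycles E" "C3 - T = {f, h}"
    using pair_cycle[OF N(1) N(3) meet(2)] by meson
  have "C1 - T \<noteq> C2 - T" "C1 - T \<noteq> C3 - T" "C1 - T \<noteq> C - T"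
      "C2 - T \<noteq> C3 - T" "C2 - T \<noteq> C - T" "C3 - T \<noteq> C - T"
    unfolding C(2) C1(2) C2(2) C3(2) using neq by auto
  then have "C1 \<noteq> C2" "C1 \<noteq> C3" "C1 \<noteq> C" "C2 \<noteq> C3" "C2 \<noteq> C" "C3 \<noteq> C"
    by auto
  then have "card {C1, C2, C3, C} = 4" by simp
  moreover have "f \<in> C - T" "f \<in> C1 - T" "f \<in> C2 - T" "f \<in> C3 - T"
    unfolding C(2) C1(2) C2(2) C3(2) by simp_all
  then have "{C1, C2, C3, C} \<subseteq> {C \<in> cycles E. f \<in> C}"
    using C(1) C1(1) C2(1) C3(1) by simp
  then have "card {C1, C2, C3, C} \<le> card {C \<in> cycles E. f \<in> C}"
    using finite_cycles by (intro card_mono) auto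
  ultimately show False using cycles_le[of f] k_le_3 N(1) by auto
qed

definition overlap :: "('a set \<times> 'a set) set" where
  "overlap = {(f, g). f \<in> N \<and> g \<in> N \<and> tpath f \<inter> tpath g \<noteq> {}}"

text \<open>Only transitivity needs an argument. If the path of g met those of f and h while these
  two were disjoint, \<open>triple_cycle_disjoint\<close> with g in the central role would give a
  cycle that \<open>no_triple_cycle\<close> forbids.\<close>

lemma equiv_overlap: "equiv N overlap"
proof (rule equivI)
  show "overlap \<subseteq> N \<times> N" by (auto simp: overlap_def)
  show "refl_on N overlap"
    using tpath_nonempty by (auto simp: refl_on_def overlap_def)
  show "sym overlap" by (auto simp: sym_def overlap_def)
  show "trans overlap"
  proof (rule transI)
    fix f g h assume fg: "(f, g) \<in> overlap" and gh: "(g, h) \<in> overlap"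
    then have N: "g \<in> N" "f \<in> N" "h \<in> N"
      and m: "tpath g \<inter> tpath f \<noteq> {}" "tpath g \<inter> tpath h \<noteq> {}"
      by (auto simp: overlap_def)
    show "(f, h) \<in> overlap"
    proof (cases "f = g \<or> g = h \<or> f = h")
      case True
      then show ?thesis using fg gh tpath_nonempty[OF N(2)] N by (auto simp: overlap_def)
    next
      case False
      then have "g \<noteq> f" "g \<noteq> h" "f \<noteq> h" by auto
      then have "tpath f \<inter> tpath h \<noteq> {}"
        using no_triple_cycle[OF N _ _ _ m] triple_cycle_disjoint[OF N m] by meson
      then show ?thesis using N by (simp add: overlap_def)
    qed
  qed
qed

lemma overlap_class:
  assumes "S \<in> N // overlap"
  shows "S \<subseteq> N" "S \<noteq> {}" "\<And>f g. f \<in> S \<Longrightarrow> g \<in> S \<Longrightarrow> tpath f \<inter> tpath g \<noteq> {}"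
proof -
  show "S \<subseteq> N" using in_quotient_imp_subset[OF equiv_overlap assms] .
  show "S \<noteq> {}" using in_quotient_imp_non_empty[OF equiv_overlap assms] .
  show "tpath f \<inter> tpath g \<noteq> {}" if "f \<in> S" "g \<in> S" for f g
    using quotient_eq_iff[OF equiv_overlap assms assms that] by (simp add: overlap_def)
qed

lemma finite_N: "finite N"
  using finite_E by simp

text \<open>Fix f in the class. Each g of the class, f itself included, gives a cycle through f with
  off-tree part {f, g}, and different g give different cycles.\<close>

lemma card_overlap_class:
  assumes S: "S \<in> N // overlap"
  shows "card S \<le> k"
proof -
  obtain f where f: "f \<in> S" using overlap_class(2)[OF S] by blast
  have fN: "f \<in> N" using f overlap_class(1)[OF S] by blast
  have "\<forall>g\<in>S. \<exists>C. C \<in> cycles E \<and> C - T = {f, g}"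
  proof
    fix g assume g: "g \<in> S"
    then have "g \<in> N" using overlap_class(1)[OF S] by blast
    then show "\<exists>C. C \<in> cycles E \<and> C - T = {f, g}"
      using pair_cycle[OF fN _ overlap_class(3)[OF S f g]] by blast
  qed
  then obtain c where c: "\<And>g. g \<in> S \<Longrightarrow> c g \<in> cycles E" "\<And>g. g \<in> S \<Longrightarrow> c g - T = {f, g}"
    by metis
  have "inj_on c S"
  proof (rule inj_onI)
    fix g g' assume "g \<in> S" "g' \<in> S" "c g = c g'"
    then have "{f, g} = {f, g'}" using c(2) by metis
    then show "g = g'" by (auto simp: doubleton_eq_iff)
  qed
  then have "card S = card (c ` S)" by (simp add: card_image)
  also have "\<dots> \<le> card {C \<in> cycles E. f \<in> C}"
  proof (rule card_mono)
    show "finite {C \<in> cycles E. f \<in> C}" using finite_cycles by simp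
    have "f \<in> c g" if "g \<in> S" for g using c(2)[OF that] by blast
    then show "c ` S \<subseteq> {C \<in> cycles E. f \<in> C}" using c(1) by blast
  qed
  also have "\<dots> \<le> k" using cycles_le fN by blast
  finally show ?thesis .
qed

text \<open>A class has one, two or three members. One path has at least two edges, two distinct
  such paths cover at least three, and three paths covering at most three would produce the cycle of
  \<open>triple_cycle_small\<close>.\<close>

lemma card_overlap_class_less:
  assumes S: "S \<in> N // overlap"
  shows "card S < card (\<Union>f\<in>S. tpath f)"
proof -
  note SN = overlap_class(1)[OF S] and meet = overlap_class(3)[OF S]
  have fin: "finite S" using SN finite_N finite_subset by blast
  then have "card S \<noteq> 0" using overlap_class(2)[OF S] by simp
  then consider "card S = 1" | "card S = 2" | "card S = 3"
    using card_overlap_class[OF S] k_le_3 by linarith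
  then show ?thesis
  proof cases
    case 1
    then obtain x where x: "S = {x}" by (meson card_1_singletonE)
    then show ?thesis using card_tpath[of x] SN by simp
  next
    case 2
    then obtain x y where xy: "S = {x, y}" "x \<noteq> y" by (meson card_2_iff)
    then have N: "x \<in> N" "y \<in> N" using SN by auto
    have "card (tpath x \<union> tpath y) > 2"
    proof (rule ccontr)
      assume "\<not> ?thesis"
      then have le: "card (tpath x \<union> tpath y) \<le> 2" by simp
      have "tpath x = tpath x \<union> tpath y"
        using le card_tpath[OF N(1)] finite_tpath by (intro card_seteq) auto
      moreover have "tpath y = tpath x \<union> tpath y"
        using le card_tpath[OF N(2)] finite_tpath by (intro card_seteq) auto
      ultimately show False using tpath_inj[OF N xy(2)] by metis
    qed
    then show ?thesis using 2 xy by simp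
  next
    case 3
    then obtain x y z where xyz: "S = {x, y, z}" "x \<noteq> y" "x \<noteq> z" "y \<noteq> z" by (metis card_3_iff)
    then have N: "x \<in> N" "y \<in> N" "z \<in> N" using SN by auto
    have m: "tpath x \<inter> tpath y \<noteq> {}" "tpath x \<inter> tpath z \<noteq> {}" using meet xyz(1) by simp_all
    have "(\<Union>f\<in>S. tpath f) = tpath x \<union> tpath y \<union> tpath z" using xyz(1) by auto
    moreover have "\<not> card (tpath x \<union> tpath y \<union> tpath z) \<le> 3"
      using triple_cycle_small[OF N xyz(2-4)] no_triple_cycle[OF N xyz(2-4) m] by argo
    ultimately show ?thesis using 3 by simp
  qed
qed

theorem card_off_tree_le: "(k + 1) * card N \<le> k * card T"
proof -
  let ?Q = "N // overlap"
  let ?U = "\<lambda>S. \<Union>f\<in>S. tpath f"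
  have finQ: "finite ?Q"
    using equiv_overlap finite_N by (intro finite_quotient) (auto simp: overlap_def)
  have fin: "finite S" if "S \<in> ?Q" for S
    using overlap_class(1)[OF that] finite_N finite_subset by blast
  have "card N = card (\<Union>?Q)" using Union_quotient[OF equiv_overlap] by simp
  also have "\<dots> = sum card ?Q"
    using quotient_disj[OF equiv_overlap] fin
    by (intro card_Union_disjoint) (auto simp: pairwise_def disjnt_def)
  finally have "(k + 1) * card N = (\<Sum>S\<in>?Q. (k + 1) * card S)" by (simp add: sum_distrib_left)
  also have "\<dots> \<le> (\<Sum>S\<in>?Q. k * card (?U S))"
  proof (rule sum_mono)
    fix S assume S: "S \<in> ?Q"
    \<comment> \<open>After cancelling, this says that the class has at most k members.\<close>
    have "(k + 1) * card S \<le> k * (card S + 1)" using card_overlap_class[OF S] by simp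
    also have "\<dots> \<le> k * card (?U S)"
      using card_overlap_class_less[OF S] by (intro mult_le_mono2) simp
    finally show "(k + 1) * card S \<le> k * card (?U S)" .
  qed
  also have "\<dots> = k * (\<Sum>S\<in>?Q. card (?U S))" by (simp add: sum_distrib_left)
  also have "(\<Sum>S\<in>?Q. card (?U S)) = card (\<Union>S\<in>?Q. ?U S)"
  proof (rule card_UN_disjoint[symmetric])
    show "finite ?Q" by (rule finQ)
    show "\<forall>S\<in>?Q. finite (?U S)" using fin finite_tpath by blast
    show "\<forall>S\<in>?Q. \<forall>S'\<in>?Q. S \<noteq> S' \<longrightarrow> ?U S \<inter> ?U S' = {}"
    proof (intro ballI impI)
      fix S S' assume S: "S \<in> ?Q" "S' \<in> ?Q" "S \<noteq> S'"
      \<comment> \<open>Paths that meet belong to the same class, so no tree edge is counted for two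
        classes.\<close>
      have "tpath f \<inter> tpath g = {}" if "f \<in> S" "g \<in> S'" for f g
      proof -
        have "(f, g) \<notin> overlap" using quotient_eqI[OF equiv_overlap S(1,2) that] S(3) by blast
        then show ?thesis using that overlap_class(1) S(1,2) unfolding overlap_def by blast
      qed
      then show "?U S \<inter> ?U S' = {}" by blast
    qed
  qed
  also have "card (\<Union>S\<in>?Q. ?U S) \<le> card T"
    using tpath_sub finite_subset[OF tree_sub finite_E] by (intro card_mono) blast+
  finally show ?thesis by simp
qed

end

section \<open>The upper bound\<close>

text \<open>A breadth-first tree works: every vertex v other than a root r is joined to a neighbour
  \<open>p v\<close> nearer to r. This takes at most one edge for each vertex of
  \<open>V - {r}\<close>.\<close>

lemma ex_spanning_tree:
  assumes "simple_graph V E" "connected_graph V E"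
  shows "\<exists>T. spanning_tree E T \<and> card T \<le> card V - 1"
proof -
  define R where "R = {(x, y). {x, y} \<in> E}"
  have finV: "finite V" and EV: "\<And>e. e \<in> E \<Longrightarrow> e \<subseteq> V" and E2: "\<And>e. e \<in> E \<Longrightarrow> card e = 2"
    using assms(1) unfolding simple_graph_def by auto
  have finE: "finite E"
    using EV finV by (intro finite_subset[of E "Pow V"]) auto
  obtain r where r: "r \<in> V" using assms(2) unfolding connected_graph_def by blast
  have conn: "(r, v) \<in> R\<^sup>*" if "v \<in> V" for v
    using assms(2) r that unfolding connected_graph_def R_def by blast
  \<comment> \<open>The distance from r; all of V is reachable, so the minimum exists where it is
    used.\<close>
  define d where "d v = (LEAST n. (r, v) \<in> R ^^ n)" for v
  have "\<exists>y. y \<in> V \<and> {y, v} \<in> E \<and> d y < d v" if v: "v \<in> V - {r}" for v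
  proof -
    obtain n where "(r, v) \<in> R ^^ n" using conn v rtrancl_imp_relpow by fast
    then have dv: "(r, v) \<in> R ^^ d v" unfolding d_def by (rule LeastI)
    have "d v \<noteq> 0"
    proof
      assume "d v = 0"
      then show False using dv v by simp
    qed
    then obtain m where m: "d v = Suc m" using not0_implies_Suc by blast
    then obtain y where y: "(r, y) \<in> R ^^ m" "(y, v) \<in> R" using dv by auto
    have "d y \<le> m" unfolding d_def using y(1) by (rule Least_le)
    moreover have "{y, v} \<in> E" using y(2) by (simp add: R_def)
    ultimately show ?thesis using m EV by fastforce
  qed
  then obtain p where p: "\<And>v. v \<in> V - {r} \<Longrightarrow> p v \<in> V"
      "\<And>v. v \<in> V - {r} \<Longrightarrow> {p v, v} \<in> E" "\<And>v. v \<in> V - {r} \<Longrightarrow> d (p v) < d v"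
    by metis
  define T where "T = (\<lambda>v. {p v, v}) ` (V - {r})"
  have TE: "T \<subseteq> E" using p(2) by (auto simp: T_def)
  have finT: "finite T" using TE finE finite_subset by blast
  have cT: "card T \<le> card V - 1"
    using card_image_le[of "V - {r}" "\<lambda>v. {p v, v}"] finV r by (simp add: T_def)
  have acyclic: "A = {}" if A: "A \<subseteq> T" "even_degrees A" for A
  proof (rule ccontr)
    assume "A \<noteq> {}"
    \<comment> \<open>The vertices whose parent edge lies in A. At one farthest from r, evenness
      forces a second edge of A, which must lead to a child, and the child is still farther
      away.\<close>
    define X where "X = {v \<in> V - {r}. {p v, v} \<in> A}"
    have "X \<noteq> {}" using \<open>A \<noteq> {}\<close> A(1) by (auto simp: X_def T_def)
    moreover have "finite X" using finV by (simp add: X_def)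
    ultimately obtain v where v: "v \<in> X" "\<And>w. w \<in> X \<Longrightarrow> d w \<le> d v"
      using Max_in[of "d ` X"] Max_ge[of "d ` X"] by (metis (no_types, lifting) finite_imageI image_iff image_is_empty)
    have vA: "{p v, v} \<in> A" using v(1) by (simp add: X_def)
    obtain e where e: "e \<in> A" "e \<noteq> {p v, v}" "v \<in> e"
      using even_degrees_other_edge[OF A(2) vA, of v] by auto
    then obtain w where w: "w \<in> V - {r}" "e = {p w, w}" using A(1) by (auto simp: T_def)
    then have "w \<in> X" using e by (simp add: X_def)
    moreover have "p w = v" using w e by auto
    ultimately show False using p(3)[OF w(1)] v(2)[of w] by simp
  qed
  \<comment> \<open>The tree path from r to v, described by its odd vertices: they are v and r, or
    none if v = r.\<close>
  have path: "\<exists>P\<subseteq>T. \<forall>w. odd (card {e \<in> P. w \<in> e}) \<longleftrightarrow> (w = v) \<noteq> (w = r)" if "v \<in> V" for v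
    using that
  proof (induction "d v" arbitrary: v rule: less_induct)
    case less
    show ?case
    proof (cases "v = r")
      case True
      then show ?thesis by (intro exI[of _ "{}"]) auto
    next
      case False
      then have v: "v \<in> V - {r}" using less.prems by simp
      obtain P where P: "P \<subseteq> T" "\<And>w. odd (card {e \<in> P. w \<in> e}) \<longleftrightarrow> (w = p v) \<noteq> (w = r)"
        using less.hyps[OF p(3)[OF v] p(1)[OF v]] by blast
      \<comment> \<open>Adding the parent edge modulo 2 moves one odd end from \<open>p v\<close> to
        v.\<close>
      let ?P = "sym_diff P {{p v, v}}"
      have "{e \<in> {{p v, v}}. w \<in> e} = (if w = p v \<or> w = v then {{p v, v}} else {})" for w
        by auto
      then have "odd (card {e \<in> {{p v, v}}. w \<in> e}) \<longleftrightarrow> w = p v \<or> w = v" for w by simp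
      moreover have "finite P" using P(1) finT finite_subset by blast
      ultimately have *: "odd (card {e \<in> ?P. w \<in> e}) \<longleftrightarrow>
          ((w = p v) \<noteq> (w = r)) \<noteq> (w = p v \<or> w = v)" for w
        using odd_degree_sym_diff[of P "{{p v, v}}" w] P(2)[of w] by simp
      have "p v \<noteq> v" using p(3)[OF v] by auto
      then have "\<forall>w. odd (card {e \<in> ?P. w \<in> e}) \<longleftrightarrow> (w = v) \<noteq> (w = r)"
        unfolding * by auto
      moreover have "?P \<subseteq> T" using P(1) v by (auto simp: T_def)
      ultimately show ?thesis by blast
    qed
  qed
  have fundamental: "\<exists>A. f \<in> A \<and> A \<subseteq> insert f T \<and> even_degrees A" if f: "f \<in> E - T" for f
  proof -
    obtain u v where uv: "f = {u, v}" "u \<noteq> v" using E2 f by (metis Diff_iff card_2_iff)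
    then have "u \<in> V" "v \<in> V" using EV f by auto
    obtain P where P: "P \<subseteq> T" "\<And>w. odd (card {e \<in> P. w \<in> e}) \<longleftrightarrow> (w = u) \<noteq> (w = r)"
      using path[OF \<open>u \<in> V\<close>] by blast
    obtain Q where Q: "Q \<subseteq> T" "\<And>w. odd (card {e \<in> Q. w \<in> e}) \<longleftrightarrow> (w = v) \<noteq> (w = r)"
      using path[OF \<open>v \<in> V\<close>] by blast
    \<comment> \<open>The odd vertices of the summands are u and r, v and r, and u and v, so all
      parities cancel.\<close>
    let ?A = "sym_diff (sym_diff P Q) {f}"
    have fin: "finite P" "finite Q" using P(1) Q(1) finT finite_subset by blast+
    have "{e \<in> {f}. w \<in> e} = (if w = u \<or> w = v then {f} else {})" for w
      using uv by auto
    then have odd_f: "odd (card {e \<in> {f}. w \<in> e}) \<longleftrightarrow> w = u \<or> w = v" for w by simp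
    have "even (card {e \<in> ?A. w \<in> e})" for w
      using odd_degree_sym_diff[of "sym_diff P Q" "{f}" w] odd_degree_sym_diff[of P Q w]
        fin P(2)[of w] Q(2)[of w] odd_f[of w] uv(2) by auto
    then have "even_degrees ?A" by (simp add: even_degrees_def)
    moreover have "f \<in> ?A" using f P(1) Q(1) by blast
    moreover have "?A \<subseteq> insert f T" using P(1) Q(1) by blast
    ultimately show ?thesis by (intro exI[of _ ?A] conjI)
  qed
  have "spanning_tree E T"
    using finE E2 TE acyclic fundamental by unfold_locales auto
  then show ?thesis using cT by blast
qed

text \<open>Splitting E into T and the edges outside T, the estimate \<open>card_off_tree_le\<close>
  adds k times \<open>card T\<close> to the k + 1 times \<open>card T\<close> from the tree.\<close>

theorem k_cactus_card_edges_le: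
  assumes "k_cactus k V E" "k \<le> 3"
  shows "(k + 1) * card E \<le> (2 * k + 1) * (card V - 1)"
proof -
  have g: "simple_graph V E" "connected_graph V E"
    and le: "\<And>e. e \<in> E \<Longrightarrow> card {C \<in> cycles E. e \<in> C} \<le> k"
    using assms(1) unfolding k_cactus_def by auto
  obtain T where T: "spanning_tree E T" "card T \<le> card V - 1"
    using ex_spanning_tree[OF g] by blast
  interpret spanning_tree E T by (rule T(1))
  interpret sparse_cycles E T k using le assms(2) by unfold_locales auto
  have "card E = card T + card N"
    using card_Diff_subset[OF finite_subset[OF tree_sub finite_E] tree_sub]
      card_mono[OF finite_E tree_sub] by simp
  then have "(k + 1) * card E = (k + 1) * card T + (k + 1) * card N" by (simp add: algebra_simps)
  also have "\<dots> \<le> (2 * k + 1) * card T" using card_off_tree_le by (simp add: algebra_simps)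
  also have "\<dots> \<le> (2 * k + 1) * (card V - 1)" using T(2) by (rule mult_le_mono2)
  finally show ?thesis .
qed

section \<open>The extremal graphs\<close>

text \<open>
  The positive vertices are cut into consecutive blocks of size \<open>k + 1\<close>; the first vertex of a block
  is the centre of its star.
\<close>

definition hub :: "nat \<Rightarrow> nat \<Rightarrow> nat" where
  "hub k v = v - (v - 1) mod (k + 1)"

text \<open>The position of v in its block is \<open>(v - 1) mod (k + 1)\<close>, and position 0 is
  the centre. The last block may be cut short by n, and its star then has fewer leaves.\<close>

definition leaves :: "nat \<Rightarrow> nat \<Rightarrow> nat set" where
  "leaves k n = {v. 1 \<le> v \<and> v < n \<and> (v - 1) mod (k + 1) \<noteq> 0}"

definition spokes :: "nat \<Rightarrow> nat set set" where
  "spokes n = (\<lambda>v. {0, v}) ` {1..<n}"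

definition rims :: "nat \<Rightarrow> nat \<Rightarrow> nat set set" where
  "rims k n = (\<lambda>v. {hub k v, v}) ` leaves k n"

lemma hub_bounds:
  assumes "v \<in> leaves k n"
  shows "1 \<le> hub k v" "hub k v < v" "v \<le> hub k v + k" "hub k v < n" "hub k v \<notin> leaves k n"
proof -
  have v: "1 \<le> v" "v < n" "(v - 1) mod (k + 1) \<noteq> 0" using assms by (auto simp: leaves_def)
  have le: "(v - 1) mod (k + 1) \<le> v - 1" by (rule mod_less_eq_dividend)
  have lt: "(v - 1) mod (k + 1) < k + 1" by (rule mod_less_divisor) simp
  show "1 \<le> hub k v" "hub k v < v" "v \<le> hub k v + k" "hub k v < n"
    using v le lt unfolding hub_def by linarith+
  \<comment> \<open>A hub has position 0: \<open>hub k v - 1\<close> is a multiple of k + 1.\<close>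
  have "hub k v - 1 = (v - 1) - (v - 1) mod (k + 1)" unfolding hub_def by simp
  then have "hub k v - 1 = (k + 1) * ((v - 1) div (k + 1))"
    by (simp only: minus_mod_eq_mult_div)
  then have "(hub k v - 1) mod (k + 1) = 0" by (simp only: mod_mult_self1_is_0)
  then show "hub k v \<notin> leaves k n" by (simp add: leaves_def)
qed

lemma leaf_pos: "v \<in> leaves k n \<Longrightarrow> v \<noteq> 0"
  by (simp add: leaves_def)

lemma finite_leaves: "finite (leaves k n)"
  by (rule finite_subset[of _ "{..<n}"]) (auto simp: leaves_def)

lemma finite_fan: "finite (spokes n \<union> rims k n)"
  by (simp add: spokes_def rims_def finite_leaves)

text \<open>A leaf is never a hub, so the only rim edge at it is its own.\<close>

lemma edge_at_leaf:
  assumes "e \<in> spokes n \<union> rims k n" "v \<in> e" "v \<in> leaves k n"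
  shows "e = {0, v} \<or> e = {hub k v, v}"
  using assms(1)
proof
  assume "e \<in> spokes n"
  then show ?thesis using assms(2) leaf_pos[OF assms(3)] by (auto simp: spokes_def)
next
  assume "e \<in> rims k n"
  then obtain w where w: "w \<in> leaves k n" "e = {hub k w, w}" by (auto simp: rims_def)
  then show ?thesis using assms(2,3) hub_bounds(5)[OF w(1)] by auto
qed

lemma edge_at_nonleaf:
  assumes "e \<in> spokes n \<union> rims k n" "h \<in> e" "h \<notin> leaves k n" "h \<noteq> 0"
  shows "e = {0, h} \<or> (\<exists>w\<in>leaves k n. hub k w = h \<and> e = {h, w})"
  using assms(1)
proof
  assume "e \<in> spokes n"
  then show ?thesis using assms by (auto simp: spokes_def)
next
  assume "e \<in> rims k n"
  then obtain w where w: "w \<in> leaves k n" "e = {hub k w, w}" by (auto simp: rims_def)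
  then have "hub k w = h" using assms by auto
  then show ?thesis using w by auto
qed

lemma card_leaves_of_hub: "card {w \<in> leaves k n. hub k w = h} \<le> k"
proof -
  have "{w \<in> leaves k n. hub k w = h} \<subseteq> {h + 1..h + k}"
    using hub_bounds(2,3) by fastforce
  then have "card {w \<in> leaves k n. hub k w = h} \<le> card {h + 1..h + k}"
    by (intro card_mono) auto
  then show ?thesis by simp
qed

text \<open>
  The spokes form a spanning tree, so a cycle is determined by the leaves whose rim edge it uses.
\<close>

definition cycle_leaves :: "nat \<Rightarrow> nat \<Rightarrow> nat set set \<Rightarrow> nat set" where
  "cycle_leaves k n C = {v \<in> leaves k n. {hub k v, v} \<in> C}"

lemma inj_on_cycle_leaves: "inj_on (cycle_leaves k n) (cycles (spokes n \<union> rims k n))"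
proof (rule inj_onI)
  let ?E = "spokes n \<union> rims k n"
  fix C C' assume C: "C \<in> cycles ?E" "C' \<in> cycles ?E" "cycle_leaves k n C = cycle_leaves k n C'"
  have sub: "C \<subseteq> ?E" "C' \<subseteq> ?E" using C(1,2) by (auto simp: cycles_def)
  have fin: "finite C" "finite C'" using sub finite_fan finite_subset by blast+
  let ?D = "sym_diff C C'"
  have ev: "even_degrees ?D"
    using even_degrees_sym_diff[OF fin] cycle_even_degrees C(1,2) by blast
  have "{hub k v, v} \<in> C \<longleftrightarrow> {hub k v, v} \<in> C'" if "v \<in> leaves k n" for v
    using C(3) that unfolding cycle_leaves_def by auto
  \<comment> \<open>Rim edges cancel in the sum. What remains is an even set of spokes, which is
    empty because each nonzero vertex is on at most one spoke.\<close>
  then have sp: "e \<in> spokes n" if "e \<in> ?D" for e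
    using that sub unfolding rims_def by auto
  have "?D = {}"
  proof (rule ccontr)
    assume "?D \<noteq> {}"
    then obtain e where e: "e \<in> ?D" by blast
    obtain v where "v \<in> {1..<n}" and v: "e = {0, v}"
      using sp[OF e] unfolding spokes_def by (rule imageE)
    then have "v \<noteq> 0" by simp
    obtain e' where e': "e' \<in> ?D" "e' \<noteq> e" "v \<in> e'"
      using even_degrees_other_edge[OF ev e, of v] v by auto
    obtain w where "e' = {0, w}"
      using sp[OF e'(1)] unfolding spokes_def by (rule imageE)
    then show False using e'(2,3) v \<open>v \<noteq> 0\<close> by auto
  qed
  then show "C = C'" by blast
qed

section \<open>Shape of the cycles in the extremal graphs\<close>

context
  fixes k n :: nat and C :: "nat set set"
  assumes C: "C \<in> cycles (spokes n \<union> rims k n)"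
begin

lemma fan_cycle_sub: "C \<subseteq> spokes n \<union> rims k n"
  using C by (simp add: cycles_def)

lemma fan_cycle_other_edge:
  assumes "e \<in> C" "v \<in> e"
  obtains e' where "e' \<in> C" "e' \<in> spokes n \<union> rims k n" "e' \<noteq> e" "v \<in> e'"
  using even_degrees_other_edge[OF cycle_even_degrees[OF C] assms] fan_cycle_sub by blast

text \<open>A cycle has degree at most two at the vertex 0.\<close>

lemma no_three_spokes:
  assumes "{0, x} \<in> C" "{0, y} \<in> C" "{0, z} \<in> C" "x \<noteq> y" "x \<noteq> z" "y \<noteq> z"
  shows False
proof -
  have "card {{0, x}, {0, y}, {0, z}} = 3"
    using assms(4-6) by (auto simp: doubleton_eq_iff card_insert_if)
  moreover have "card {{0, x}, {0, y}, {0, z}} \<le> card {e \<in> C. 0 \<in> e}"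
    using assms finite_subset[OF fan_cycle_sub finite_fan] by (intro card_mono) auto
  ultimately show False using cycle_degrees[OF C, of 0] by auto
qed

text \<open>A leaf is on just these two edges, so a cycle uses both or neither.\<close>

lemma leaf_spoke_iff:
  assumes "v \<in> leaves k n"
  shows "{0, v} \<in> C \<longleftrightarrow> {hub k v, v} \<in> C"
proof
  assume e: "{0, v} \<in> C"
  obtain e' where "e' \<in> C" "e' \<in> spokes n \<union> rims k n" "e' \<noteq> {0, v}" "v \<in> e'"
    by (rule fan_cycle_other_edge[OF e, of v]) auto
  then show "{hub k v, v} \<in> C" using edge_at_leaf[OF _ _ assms] by metis
next
  assume e: "{hub k v, v} \<in> C"
  obtain e' where "e' \<in> C" "e' \<in> spokes n \<union> rims k n" "e' \<noteq> {hub k v, v}" "v \<in> e'"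
    by (rule fan_cycle_other_edge[OF e, of v]) auto
  then show "{0, v} \<in> C" using edge_at_leaf[OF _ _ assms] by metis
qed

text \<open>The cycle leaves h by a rim edge to a leaf w and then uses the spoke of w. Both spokes
  at 0 are now taken, and any further leaf would require a third.\<close>

lemma nonleaf_spoke:
  assumes "{0, h} \<in> C" "h \<notin> leaves k n" "h \<noteq> 0"
  shows "\<exists>w\<in>leaves k n. hub k w = h \<and> cycle_leaves k n C = {w}"
proof -
  obtain e' where e': "e' \<in> C" "e' \<in> spokes n \<union> rims k n" "e' \<noteq> {0, h}" "h \<in> e'"
    by (rule fan_cycle_other_edge[OF assms(1), of h]) auto
  then obtain w where w: "w \<in> leaves k n" "hub k w = h" "e' = {h, w}"
    using edge_at_nonleaf[OF e'(2,4) assms(2,3)] by auto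
  then have wC: "{0, w} \<in> C" using e'(1) leaf_spoke_iff[OF w(1)] by simp
  have "x = w" if x: "x \<in> cycle_leaves k n C" for x
  proof (rule ccontr)
    assume "x \<noteq> w"
    have xl: "x \<in> leaves k n" "{0, x} \<in> C" using x leaf_spoke_iff by (auto simp: cycle_leaves_def)
    moreover have "h \<noteq> w" "h \<noteq> x" using assms(2) w(1) xl(1) by auto
    ultimately show False using no_three_spokes[OF assms(1) wC xl(2)] \<open>x \<noteq> w\<close> by simp
  qed
  moreover have "w \<in> cycle_leaves k n C" using w e'(1) by (simp add: cycle_leaves_def)
  ultimately have "cycle_leaves k n C = {w}" by blast
  then show ?thesis using w by blast
qed

text \<open>The spokes of v and w already use up the degree at 0. The cycle must also leave
  \<open>hub k v\<close> by a second edge, which is its spoke or leads to another leaf of the same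
  star; either way a third spoke appears.\<close>

lemma cycle_leaves_same_hub:
  assumes "v \<in> cycle_leaves k n C" "w \<in> cycle_leaves k n C"
  shows "hub k v = hub k w"
proof (rule ccontr)
  assume neq: "hub k v \<noteq> hub k w"
  have v: "v \<in> leaves k n" "{hub k v, v} \<in> C" "{0, v} \<in> C"
    and w: "w \<in> leaves k n" "{0, w} \<in> C"
    using assms leaf_spoke_iff by (auto simp: cycle_leaves_def)
  note h = hub_bounds[OF v(1)]
  obtain e' where e': "e' \<in> C" "e' \<in> spokes n \<union> rims k n" "e' \<noteq> {hub k v, v}" "hub k v \<in> e'"
    by (rule fan_cycle_other_edge[OF v(2), of "hub k v"]) auto
  have "hub k v \<noteq> 0" using h(1) by simp
  from edge_at_nonleaf[OF e'(2,4) h(5) this] show False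
  proof
    assume "e' = {0, hub k v}"
    then have "{0, hub k v} \<in> C" using e'(1) by simp
    moreover have "hub k v \<noteq> v" "hub k v \<noteq> w" "v \<noteq> w" using h(5) v(1) w(1) neq by auto
    ultimately show False using no_three_spokes v(3) w(2) by blast
  next
    assume "\<exists>x\<in>leaves k n. hub k x = hub k v \<and> e' = {hub k v, x}"
    then obtain x where x: "x \<in> leaves k n" "hub k x = hub k v" "e' = {hub k v, x}" by blast
    then have "{0, x} \<in> C" using leaf_spoke_iff[OF x(1)] e'(1) by simp
    moreover have "x \<noteq> v" "x \<noteq> w" "v \<noteq> w" using x e'(3) neq by auto
    ultimately show False using no_three_spokes v(3) w(2) by blast
  qed
qed

text \<open>Every leaf on the cycle costs a spoke, so there are at most two. The choice w = v covers
  a cycle with a single leaf, which lets the leaves of one star index all cycles through v.\<close>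

lemma cycle_leaves_eq_pair:
  assumes "v \<in> cycle_leaves k n C"
  shows "\<exists>w\<in>leaves k n. hub k w = hub k v \<and> cycle_leaves k n C = {v, w}"
proof (cases "cycle_leaves k n C = {v}")
  case True
  then show ?thesis using assms by (auto simp: cycle_leaves_def)
next
  case False
  then obtain w where w: "w \<in> cycle_leaves k n C" "w \<noteq> v" using assms by blast
  have sp: "{0, x} \<in> C" if "x \<in> cycle_leaves k n C" for x
    using that leaf_spoke_iff by (auto simp: cycle_leaves_def)
  have "x = v \<or> x = w" if "x \<in> cycle_leaves k n C" for x
    using no_three_spokes[OF sp[OF assms] sp[OF w(1)] sp[OF that]] w(2) by metis
  then have "cycle_leaves k n C = {v, w}" using assms w(1) by blast
  moreover have "w \<in> leaves k n" using w(1) by (simp add: cycle_leaves_def)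
  ultimately show ?thesis using cycle_leaves_same_hub[OF w(1) assms] by blast
qed

end

text \<open>If e contains a leaf v, the cycles through e have leaf sets {v, w} with w in the star of
  v. Otherwise e is the spoke of some nonleaf h and the leaf sets are {w} with w in the star of h.
  In both cases a star with at most k leaves indexes the cycles.\<close>

lemma card_fan_cycles_le:
  assumes "e \<in> spokes n \<union> rims k n"
  shows "card {C \<in> cycles (spokes n \<union> rims k n). e \<in> C} \<le> k"
proof -
  let ?X = "{C \<in> cycles (spokes n \<union> rims k n). e \<in> C}"
  let ?B = "\<lambda>h. {w \<in> leaves k n. hub k w = h}"
  have "\<exists>h g. cycle_leaves k n ` ?X \<subseteq> g ` ?B h"
  proof (cases "\<exists>v\<in>leaves k n. v \<in> e")
    case True
    then obtain v where v: "v \<in> leaves k n" "v \<in> e" by blast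
    have "cycle_leaves k n C \<in> (\<lambda>w. {v, w}) ` ?B (hub k v)" if "C \<in> ?X" for C
    proof -
      have C: "C \<in> cycles (spokes n \<union> rims k n)" "e \<in> C" using that by auto
      then have "v \<in> cycle_leaves k n C"
        using edge_at_leaf[OF assms v(2,1)] leaf_spoke_iff[OF C(1) v(1)] v(1)
        by (auto simp: cycle_leaves_def)
      then show ?thesis using cycle_leaves_eq_pair[OF C(1)] by auto
    qed
    then show ?thesis by blast
  next
    case False
    then have "e \<in> spokes n" using assms by (auto simp: rims_def)
    then obtain h where "h \<in> {1..<n}" and h: "e = {0, h}"
      unfolding spokes_def by (rule imageE)
    then have "h \<noteq> 0" by simp
    have nl: "h \<notin> leaves k n" using False h by auto
    have "cycle_leaves k n C \<in> (\<lambda>w. {w}) ` ?B h" if "C \<in> ?X" for C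
      using nonleaf_spoke[of C n k h] that h nl \<open>h \<noteq> 0\<close> by auto
    then show ?thesis by blast
  qed
  then obtain h g where hg: "cycle_leaves k n ` ?X \<subseteq> g ` ?B h" by iprover
  have "inj_on (cycle_leaves k n) ?X"
    using inj_on_cycle_leaves by (rule inj_on_subset) auto
  then have "card ?X = card (cycle_leaves k n ` ?X)" by (simp add: card_image)
  also have "\<dots> \<le> card (g ` ?B h)" using hg finite_leaves by (intro card_mono) auto
  also have "\<dots> \<le> card (?B h)" using finite_leaves by (intro card_image_le) auto
  also have "\<dots> \<le> k" by (rule card_leaves_of_hub)
  finally show ?thesis .
qed

theorem k_cactus_fan:
  assumes "n \<ge> 1"
  shows "k_cactus k {..<n} (spokes n \<union> rims k n)"
  unfolding k_cactus_def
proof (intro conjI ballI)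
  show "simple_graph {..<n} (spokes n \<union> rims k n)"
  proof -
    have "e \<subseteq> {..<n} \<and> card e = 2" if e: "e \<in> spokes n \<union> rims k n" for e
      using e
    proof
      assume "e \<in> spokes n"
      then show ?thesis by (auto simp: spokes_def)
    next
      assume "e \<in> rims k n"
      then obtain w where w: "w \<in> leaves k n" "e = {hub k w, w}" by (auto simp: rims_def)
      then show ?thesis using hub_bounds[OF w(1)] by (auto simp: leaves_def)
    qed
    then show ?thesis by (simp add: simple_graph_def)
  qed
  show "connected_graph {..<n} (spokes n \<union> rims k n)"
    unfolding connected_graph_def
  proof (intro conjI ballI)
    show "{..<n} \<noteq> {}" using assms lessThan_empty_iff[of n] by simp
    fix u v assume uv: "u \<in> {..<n}" "v \<in> {..<n}"
    let ?R = "{(x, y). {x, y} \<in> spokes n \<union> rims k n}"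
    have "(0, x) \<in> ?R\<^sup>* \<and> (x, 0) \<in> ?R\<^sup>*" if "x < n" for x
    proof (cases "x = 0")
      case False
      then have "{0, x} \<in> spokes n" using that by (auto simp: spokes_def)
      then have "(0, x) \<in> ?R" "(x, 0) \<in> ?R" by (simp_all add: insert_commute)
      then show ?thesis by blast
    qed simp
    then show "(u, v) \<in> ?R\<^sup>*" using uv by (meson lessThan_iff rtrancl_trans)
  qed
  fix e assume "e \<in> spokes n \<union> rims k n"
  then show "card {C \<in> cycles (spokes n \<union> rims k n). e \<in> C} \<le> k"
    by (rule card_fan_cycles_le)
qed

section \<open>Number of edges in the extremal graphs\<close>

lemma card_leaves:
  assumes "k \<in> {2, 3}"
  shows "card (leaves k (Suc m)) = k * m div (k + 1)"
proof (induction m)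
  case 0
  have "leaves k (Suc 0) = {}" by (auto simp: leaves_def)
  then show ?case by simp
next
  case (Suc m)
  have "leaves k (Suc (Suc m)) =
      (if m mod (k + 1) \<noteq> 0 then insert (Suc m) (leaves k (Suc m)) else leaves k (Suc m))"
    by (auto simp: leaves_def less_Suc_eq)
  moreover have "Suc m \<notin> leaves k (Suc m)" by (simp add: leaves_def)
  ultimately have "card (leaves k (Suc (Suc m))) =
      k * m div (k + 1) + (if m mod (k + 1) \<noteq> 0 then 1 else 0)"
    using Suc finite_leaves by simp
  \<comment> \<open>The quotient \<open>k * m div (k + 1)\<close> is m minus the ceiling of m / (k +
    1), so the step from m to m + 1 leaves it unchanged exactly when k + 1 divides m. Once k is a
    numeral this is linear arithmetic.\<close>
  also have "\<dots> = k * Suc m div (k + 1)"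
    using assms
  proof
    assume "k = 2"
    then show ?thesis by simp presburger
  next
    assume "k \<in> {3}"
    then have "k = 3" by simp
    then show ?thesis by simp presburger
  qed
  finally show ?case .
qed

text \<open>There are m spokes, all containing 0, and one rim edge per leaf, none containing 0. The
  m spokes are then absorbed into the quotient as m (k + 1) / (k + 1).\<close>

lemma card_fan:
  assumes "k \<in> {2, 3}"
  shows "card (spokes (Suc m) \<union> rims k (Suc m)) = (2 * k + 1) * m div (k + 1)"
proof -
  have "card (spokes (Suc m)) = m"
    unfolding spokes_def by (subst card_image) (auto simp: inj_on_def doubleton_eq_iff)
  moreover have "card (rims k (Suc m)) = card (leaves k (Suc m))"
    unfolding rims_def
  proof (rule card_image, rule inj_onI)
    fix v w assume vw: "v \<in> leaves k (Suc m)" "w \<in> leaves k (Suc m)" "{hub k v, v} = {hub k w, w}"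
    then show "v = w" using hub_bounds(2)[OF vw(1)] hub_bounds(2)[OF vw(2)]
      by (auto simp: doubleton_eq_iff)
  qed
  moreover have "spokes (Suc m) \<inter> rims k (Suc m) = {}"
  proof -
    have "0 \<notin> e" if "e \<in> rims k (Suc m)" for e
      using that hub_bounds(1) leaf_pos by (fastforce simp: rims_def)
    then show ?thesis by (auto simp: spokes_def)
  qed
  ultimately have "card (spokes (Suc m) \<union> rims k (Suc m)) = m + k * m div (k + 1)"
    using finite_fan card_leaves[OF assms] by (simp add: card_Un_disjoint)
  also have "\<dots> = (k * m + m * (k + 1)) div (k + 1)" by (subst div_mult_self1) auto
  also have "k * m + m * (k + 1) = (2 * k + 1) * m" by (simp add: algebra_simps)
  finally show ?thesis .
qed

theorem theorem3:
  fixes k :: nat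
  assumes "k \<in> {2, 3}"
  shows "(\<forall>(V :: 'a set) E n. k_cactus k V E \<and> card V = n \<longrightarrow>
            int (card E) \<le> \<lfloor>(2 * real k + 1) * (real n - 1) / (real k + 1)\<rfloor>) \<and>
         (\<forall>n::nat. n \<ge> 1 \<longrightarrow>
            (\<exists>(V :: nat set) E. k_cactus k V E \<and> card V = n \<and>
               int (card E) = \<lfloor>(2 * real k + 1) * (real n - 1) / (real k + 1)\<rfloor>))"
proof (intro conjI allI impI)
  \<comment> \<open>For n \<ge> 1 truncated subtraction agrees with the real n - 1, so the floor
    becomes division of naturals.\<close>
  have bound: "\<lfloor>(2 * real k + 1) * (real n - 1) / (real k + 1)\<rfloor>
      = int ((2 * k + 1) * (n - 1) div (k + 1))" if "n \<ge> 1" for n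
  proof -
    have "(2 * real k + 1) * (real n - 1) / (real k + 1)
        = real ((2 * k + 1) * (n - 1)) / real (k + 1)"
      using that by (cases n) (simp_all add: algebra_simps)
    then show ?thesis by (simp only: floor_divide_of_nat_eq)
  qed
  {
    fix V :: "'a set" and E n
    assume VE: "k_cactus k V E \<and> card V = n"
    \<comment> \<open>Connectedness excludes the null graph, for which the bound would be
      negative.\<close>
    then have "finite V" "V \<noteq> {}"
      by (auto simp: k_cactus_def simple_graph_def connected_graph_def)
    then have "card V > 0" by (simp add: card_gt_0_iff)
    then have n: "n \<ge> 1" using VE by linarith
    have "(k + 1) * card E \<le> (2 * k + 1) * (n - 1)"
      using k_cactus_card_edges_le[of k V E] VE assms by auto
    then have "card E \<le> (2 * k + 1) * (n - 1) div (k + 1)"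
      by (simp add: less_eq_div_iff_mult_less_eq mult.commute)
    then show "int (card E) \<le> \<lfloor>(2 * real k + 1) * (real n - 1) / (real k + 1)\<rfloor>"
      unfolding bound[OF n] by (simp only: of_nat_le_iff)
  next
    fix n :: nat
    assume n: "n \<ge> 1"
    then obtain m where m: "n = Suc m" by (cases n) auto
    have "int (card (spokes n \<union> rims k n)) = int ((2 * k + 1) * (n - 1) div (k + 1))"
      using card_fan[OF assms, of m] m by simp
    then show "\<exists>(V :: nat set) E. k_cactus k V E \<and> card V = n \<and>
        int (card E) = \<lfloor>(2 * real k + 1) * (real n - 1) / (real k + 1)\<rfloor>"
      unfolding bound[OF n] using k_cactus_fan[OF n, of k]
      by (intro exI[of _ "{..<n}"] exI[of _ "spokes n \<union> rims k n"] conjI) simp_all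
  }
qed

end
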